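(* Let $n$ be a positive integer and let $G$ be the directed acyclic graph on $V=\{1,\ldots,n\}$ with $i\to j$ if and only if $i<j$; let $D$ be its edge set. Then for every choice of distinct $i_0,j_0\in V$ and $S\subseteq V\setminus\{i_0,j_0\}$, the hypersurface $H_f\subseteq\mathbb{R}^D$ defined by $f=\det(\Sigma[S\cup\{i_0\},S\cup\{j_0\}])$ is nonsingular, where $\Sigma=(I-A)^{-T}(I-A)^{-1}$.
   Context: $A$ is the $n\times n$ matrix whose $(i,j)$-entry is the variable (real parameter) $a_{ij}$ if $i<j$ and $0$ otherwise; it is nilpotent, so the entries of $\Sigma=(I-A)^{-T}(I-A)^{-1}$ are polynomials in the $a_{ij}$. For $K,L\subseteq V$, $\Sigma[K,L]$ is the $K\times L$ submatrix of $\Sigma$ (rows and columns in increasing order). $H_f$ is the zero locus of $f$ in $\mathbb{R}^D$. $H_f$ is called nonsingular if there is no point of $\mathbb{R}^D$ at which $f$ and all its partial derivatives $\partial f/\partial a_{ij}$, $(i,j)\in D$, vanish simultaneously. *)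

theory Defs
  imports
    Complex_Main
    "HOL-Library.FuncSet"
    "Jordan_Normal_Form.DL_Submatrix"
    "Jordan_Normal_Form.Gauss_Jordan_Elimination"
    "Jordan_Normal_Form.Determinant"
begin

text \<open>
  Vertices are \<open>{1..n}\<close>, whereas library matrices are indexed from \<open>0\<close>: vertex \<open>k\<close>
  corresponds to row/column index \<open>k - 1\<close>.  A point of \<open>\<real>\<^sup>D\<close> is a function
  \<open>nat \<times> nat \<Rightarrow> real\<close> in \<open>extensional D\<close>.
\<close>

definition dag_edges :: "nat \<Rightarrow> (nat \<times> nat) set" where
  "dag_edges n = {(i, j) \<in> {1..n} \<times> {1..n}. i < j}"

definition weight_mat :: "nat \<Rightarrow> (nat \<times> nat \<Rightarrow> real) \<Rightarrow> real mat" where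
  "weight_mat n a =
     mat n n (\<lambda>(i, j). if (Suc i, Suc j) \<in> dag_edges n then a (Suc i, Suc j) else 0)"

text \<open>The matrix \<open>I - A\<close> is always invertible, see \<open>inv_I_minus_A\<close> below.\<close>

definition inv_I_minus :: "nat \<Rightarrow> (nat \<times> nat \<Rightarrow> real) \<Rightarrow> real mat" where
  "inv_I_minus n a = the (mat_inverse (1\<^sub>m n - weight_mat n a))"

definition Sigma_mat :: "nat \<Rightarrow> (nat \<times> nat \<Rightarrow> real) \<Rightarrow> real mat" where
  "Sigma_mat n a = transpose_mat (inv_I_minus n a) * inv_I_minus n a"

text \<open>The submatrix with rows and columns labelled by the vertex sets \<open>K\<close> and \<open>L\<close>.\<close>

definition vertex_submatrix :: "real mat \<Rightarrow> nat set \<Rightarrow> nat set \<Rightarrow> real mat" where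
  "vertex_submatrix M K L = submatrix M {k. Suc k \<in> K} {l. Suc l \<in> L}"

definition hypersurface :: "'e set \<Rightarrow> (('e \<Rightarrow> real) \<Rightarrow> real) \<Rightarrow> ('e \<Rightarrow> real) set" where
  "hypersurface D f = {a \<in> extensional D. f a = 0}"

text \<open>Meant for \<open>f\<close> polynomial in the coordinates, so that all partial derivatives exist.\<close>

definition nonsingular_hypersurface :: "'e set \<Rightarrow> (('e \<Rightarrow> real) \<Rightarrow> real) \<Rightarrow> bool" where
  "nonsingular_hypersurface D f \<longleftrightarrow>
     \<not> (\<exists>a \<in> hypersurface D f. \<forall>e \<in> D.
          ((\<lambda>t. f (a(e := t))) has_real_derivative 0) (at (a e)))"

lemma inv_I_minus_A:
  fixes n :: nat and a :: "nat \<times> nat \<Rightarrow> real"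
  defines "M \<equiv> 1\<^sub>m n - weight_mat n a"
  shows "inv_I_minus n a \<in> carrier_mat n n"
    and "M * inv_I_minus n a = 1\<^sub>m n" and "inv_I_minus n a * M = 1\<^sub>m n"
proof -
  have M: "M \<in> carrier_mat n n"
    by (simp add: M_def weight_mat_def minus_mat_def)
  have ut: "upper_triangular M"
    by (auto simp: upper_triangular_def M_def weight_mat_def dag_edges_def)
  have "det M = prod_list (diag_mat M)"
    using det_upper_triangular[OF ut M] .
  also have "diag_mat M = map (\<lambda>_. 1) [0..<n]"
    using M by (auto simp: diag_mat_def M_def weight_mat_def dag_edges_def)
  finally have "det M \<noteq> 0"
    by (simp add: map_replicate_const)
  then have "M \<in> Units (ring_mat TYPE(real) n ())"
    by (rule det_non_zero_imp_unit[OF M])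
  then obtain B where B: "mat_inverse M = Some B"
    using mat_inverse(1)[OF M, where b = "()"] by (cases "mat_inverse M") auto
  then have "inv_I_minus n a = B"
    by (simp add: inv_I_minus_def M_def)
  then show "inv_I_minus n a \<in> carrier_mat n n"
    and "M * inv_I_minus n a = 1\<^sub>m n" and "inv_I_minus n a * M = 1\<^sub>m n"
    using mat_inverse(2)[OF M B] by auto
qed

end

(* Let B = (I - A)^(-1) with columns b_1, ..., b_n, so that Sigma is the Gram matrix of the b_k, and
   assume i0 < j0 (Sigma is symmetric). Replacing I - A by (I - t E)(I - A), where E is the matrix
   unit at (i0, j0), moves A along a line in R^D and replaces B by B (I + t E), that is, b_j0 by
   b_j0 + t b_i0. The minor f is linear in the column b_j0, hence along this line it equals f(a) + t c
   with c = +- det Sigma[S + i0, S + i0], a Gram determinant of linearly independent vectors. So the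
   directional derivative c of f is nonzero, and by the chain rule not all partial derivatives of f
   vanish, at any point. *)

theory Submission
  imports Defs
begin

section \<open>Chain rule along lines for polynomial functions\<close>

text \<open>
  The space \<open>'e \<Rightarrow> real\<close> is not normed, so the chain rule for polynomials along lines is obtained
  from closure properties of this predicate instead of Frechet differentiability.
\<close>

definition chain_rule_at :: "'e set \<Rightarrow> ('e \<Rightarrow> real) \<Rightarrow> (('e \<Rightarrow> real) \<Rightarrow> real) \<Rightarrow> bool" where
  "chain_rule_at D a f \<longleftrightarrow>
     (\<exists>g. (\<forall>e\<in>D. ((\<lambda>t. f (a(e := t))) has_real_derivative g e) (at (a e))) \<and>
          (\<forall>v. ((\<lambda>t. f (\<lambda>e. a e + t * v e)) has_real_derivative (\<Sum>e\<in>D. g e * v e)) (at 0)))"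

lemma chain_rule_at_const: "chain_rule_at D a (\<lambda>_. c)"
  unfolding chain_rule_at_def by (intro exI[of _ "\<lambda>_. 0"]) auto

lemma chain_rule_at_coord:
  assumes "finite D" "d \<in> D"
  shows "chain_rule_at D a (\<lambda>x. x d)"
  unfolding chain_rule_at_def
proof (intro exI[of _ "\<lambda>e. if e = d then 1 else 0"] conjI ballI allI)
  fix e
  show "((\<lambda>t. (a(e := t)) d) has_real_derivative (if e = d then 1 else 0)) (at (a e))"
    by auto
next
  fix v :: "'a \<Rightarrow> real"
  have "(\<Sum>e\<in>D. (if e = d then 1 else 0) * v e) = (\<Sum>e\<in>D. if d = e then v e else 0)"
    by (intro sum.cong) auto
  also have "\<dots> = v d"
    using assms by simp
  finally show "((\<lambda>t. a d + t * v d) has_real_derivative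
      (\<Sum>e\<in>D. (if e = d then 1 else 0) * v e)) (at 0)"
    by (auto intro!: derivative_eq_intros)
qed

lemma chain_rule_at_add:
  assumes "chain_rule_at D a f1" "chain_rule_at D a f2"
  shows "chain_rule_at D a (\<lambda>x. f1 x + f2 x)"
proof -
  from assms obtain g1 g2 where
    g: "\<forall>e\<in>D. ((\<lambda>t. f1 (a(e := t))) has_real_derivative g1 e) (at (a e))"
       "\<forall>e\<in>D. ((\<lambda>t. f2 (a(e := t))) has_real_derivative g2 e) (at (a e))"
       "\<forall>v. ((\<lambda>t. f1 (\<lambda>e. a e + t * v e)) has_real_derivative (\<Sum>e\<in>D. g1 e * v e)) (at 0)"
       "\<forall>v. ((\<lambda>t. f2 (\<lambda>e. a e + t * v e)) has_real_derivative (\<Sum>e\<in>D. g2 e * v e)) (at 0)"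
    unfolding chain_rule_at_def by blast
  show ?thesis
    unfolding chain_rule_at_def
    using g by (intro exI[of _ "\<lambda>e. g1 e + g2 e"])
      (simp add: DERIV_add distrib_right sum.distrib)
qed

lemma chain_rule_at_mult:
  assumes "chain_rule_at D a f1" "chain_rule_at D a f2"
  shows "chain_rule_at D a (\<lambda>x. f1 x * f2 x)"
proof -
  from assms obtain g1 g2 where
    g: "\<forall>e\<in>D. ((\<lambda>t. f1 (a(e := t))) has_real_derivative g1 e) (at (a e))"
       "\<forall>e\<in>D. ((\<lambda>t. f2 (a(e := t))) has_real_derivative g2 e) (at (a e))"
       "\<forall>v. ((\<lambda>t. f1 (\<lambda>e. a e + t * v e)) has_real_derivative (\<Sum>e\<in>D. g1 e * v e)) (at 0)"
       "\<forall>v. ((\<lambda>t. f2 (\<lambda>e. a e + t * v e)) has_real_derivative (\<Sum>e\<in>D. g2 e * v e)) (at 0)"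
    unfolding chain_rule_at_def by blast
  show ?thesis
    unfolding chain_rule_at_def
  \<comment> \<open>Both curves pass through \<open>a\<close> at their base parameter, so the
    product rule gives these coefficients for the coordinate derivatives and for the line
    derivatives alike.\<close>
  proof (intro exI[of _ "\<lambda>e. g1 e * f2 a + g2 e * f1 a"] conjI ballI allI)
    fix e assume "e \<in> D"
    with g(1,2) show "((\<lambda>t. f1 (a(e := t)) * f2 (a(e := t))) has_real_derivative
        g1 e * f2 a + g2 e * f1 a) (at (a e))"
      using DERIV_mult[of "\<lambda>t. f1 (a(e := t))" "g1 e" "a e" UNIV "\<lambda>t. f2 (a(e := t))" "g2 e"]
      by simp
  next
    fix v :: "'a \<Rightarrow> real"
    show "((\<lambda>t. f1 (\<lambda>e. a e + t * v e) * f2 (\<lambda>e. a e + t * v e)) has_real_derivative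
        (\<Sum>e\<in>D. (g1 e * f2 a + g2 e * f1 a) * v e)) (at 0)"
      using DERIV_mult[OF g(3)[rule_format, of v] g(4)[rule_format, of v]]
      by (simp add: distrib_left sum.distrib sum_distrib_left mult_ac)
  qed
qed

lemma chain_rule_at_sum:
  assumes "\<And>i. i \<in> I \<Longrightarrow> chain_rule_at D a (F i)"
  shows "chain_rule_at D a (\<lambda>x. \<Sum>i\<in>I. F i x)"
  using assms
  by (induction I rule: infinite_finite_induct)
     (auto intro: chain_rule_at_const chain_rule_at_add)

lemma chain_rule_at_prod:
  assumes "\<And>i. i \<in> I \<Longrightarrow> chain_rule_at D a (F i)"
  shows "chain_rule_at D a (\<lambda>x. \<Prod>i\<in>I. F i x)"
  using assms
  by (induction I rule: infinite_finite_induct)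
     (auto intro: chain_rule_at_const chain_rule_at_mult)

text \<open>The Leibniz formula turns the determinant into a signed sum of products of entries, so
  closure under sums and products applies.\<close>

lemma chain_rule_at_det:
  assumes "\<And>k l. k < m \<Longrightarrow> l < m \<Longrightarrow> chain_rule_at D a (\<lambda>x. F x k l)"
  shows "chain_rule_at D a (\<lambda>x. det (mat m m (\<lambda>(k, l). F x k l)))"
proof -
  have "det (mat m m (\<lambda>(k, l). F x k l)) =
      (\<Sum>p\<in>{p. p permutes {0..<m}}. signof p * (\<Prod>k = 0..<m. F x k (p k)))" for x
    by (subst det_def'[of _ m])
       (auto intro!: sum.cong prod.cong arg_cong2[where f = "(*)"] dest: permutes_in_image)
  moreover have "chain_rule_at D a
      (\<lambda>x. \<Sum>p\<in>{p. p permutes {0..<m}}. signof p * (\<Prod>k = 0..<m. F x k (p k)))"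
  proof (intro chain_rule_at_sum chain_rule_at_mult chain_rule_at_const chain_rule_at_prod)
    fix p k assume "p \<in> {p. p permutes {0..<m}}" "k \<in> {0..<m}"
    moreover from this have "p k \<in> {0..<m}"
      by (simp add: permutes_in_image)
    ultimately show "chain_rule_at D a (\<lambda>x. F x k (p k))"
      by (intro assms) auto
  qed
  ultimately show ?thesis
    by simp
qed

text \<open>Derivatives are unique, so the gradient coefficients supplied by the chain rule must all
  be 0 at a critical point. A single direction with nonzero derivative therefore excludes
  criticality.\<close>

lemma line_derivative_eq_0:
  assumes "chain_rule_at D a f"
    and "\<And>e. e \<in> D \<Longrightarrow> ((\<lambda>t. f (a(e := t))) has_real_derivative 0) (at (a e))"
  shows "((\<lambda>t. f (\<lambda>e. a e + t * v e)) has_real_derivative 0) (at 0)"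
proof -
  from assms(1) obtain g where
    g: "\<forall>e\<in>D. ((\<lambda>t. f (a(e := t))) has_real_derivative g e) (at (a e))"
       "((\<lambda>t. f (\<lambda>e. a e + t * v e)) has_real_derivative (\<Sum>e\<in>D. g e * v e)) (at 0)"
    unfolding chain_rule_at_def by blast
  have "g e = 0" if "e \<in> D" for e
    using DERIV_unique g(1) assms(2) that by blast
  then have "(\<Sum>e\<in>D. g e * v e) = 0"
    by simp
  with g(2) show ?thesis
    by simp
qed

section \<open>Gram determinants and linearity in a column\<close>

text \<open>A kernel vector \<open>v\<close> yields a combination \<open>c\<close> of the columns
  \<open>r l\<close> of \<open>B\<close> that is orthogonal to all columns \<open>p k\<close>. As
  \<open>p\<close> and \<open>r\<close> have the same image, \<open>c\<close> is orthogonal to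
  itself and hence 0. Allowing two enumerations of one column set covers Gram matrices whose rows
  and columns are ordered differently.\<close>

lemma det_gram_nonzero:
  fixes B C :: "nat \<Rightarrow> nat \<Rightarrow> real"
  assumes inv: "\<And>k l. k < n \<Longrightarrow> l < n \<Longrightarrow> (\<Sum>x<n. C k x * B x l) = (if k = l then 1 else 0)"
    and inj: "inj_on r {..<m}" and range: "r ` {..<m} \<subseteq> {..<n}"
    and same: "p ` {..<m} = r ` {..<m}"
  shows "det (mat m m (\<lambda>(k, l). \<Sum>x<n. B x (p k) * B x (r l))) \<noteq> 0" (is "det ?M \<noteq> 0")
proof
  assume "det ?M = 0"
  then obtain v where v: "v \<in> carrier_vec m" "v \<noteq> 0\<^sub>v m" "?M *\<^sub>v v = 0\<^sub>v m"
    using det_0_iff_vec_prod_zero_field[of ?M m] by auto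
  define c where "c x = (\<Sum>l<m. B x (r l) * v $ l)" for x
  have p0: "(\<Sum>x<n. B x (p k) * c x) = 0" if "k < m" for k
  proof -
    have "(\<Sum>x<n. B x (p k) * c x) = (\<Sum>x<n. \<Sum>l<m. B x (p k) * B x (r l) * v $ l)"
      by (simp add: c_def sum_distrib_left mult.assoc)
    also have "\<dots> = (\<Sum>l<m. (\<Sum>x<n. B x (p k) * B x (r l)) * v $ l)"
      by (subst sum.swap) (simp add: sum_distrib_right)
    also have "\<dots> = (?M *\<^sub>v v) $ k"
      using that v(1) by (simp add: scalar_prod_def atLeast0LessThan)
    finally show ?thesis
      using v(3) that by simp
  qed
  have r0: "(\<Sum>x<n. B x (r l) * c x) = 0" if "l < m" for l
  proof -
    have "r l \<in> p ` {..<m}"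
      using that same by auto
    then show ?thesis
      using p0 by auto
  qed
  have "(\<Sum>x<n. c x * c x) = (\<Sum>x<n. \<Sum>l<m. v $ l * (B x (r l) * c x))"
    by (subst (1) c_def) (simp add: sum_distrib_right sum_distrib_left mult_ac)
  also have "\<dots> = (\<Sum>l<m. v $ l * (\<Sum>x<n. B x (r l) * c x))"
    by (subst sum.swap) (simp add: sum_distrib_left)
  also have "\<dots> = 0"
    using r0 by simp
  finally have c0: "c x = 0" if "x < n" for x
    using that by (subst (asm) sum_nonneg_eq_0_iff) auto
  have "v $ q = 0" if "q < m" for q
  proof -
    have rq: "r q < n"
      using that range by auto
    \<comment> \<open>Row \<open>r q\<close> of the left inverse \<open>C\<close> reads off the
      coefficient of column \<open>r q\<close> in \<open>c\<close>; by injectivity of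
      \<open>r\<close> this is \<open>v $ q\<close> alone.\<close>
    have "0 = (\<Sum>x<n. C (r q) x * c x)"
      using c0 by simp
    also have "\<dots> = (\<Sum>x<n. \<Sum>l<m. C (r q) x * B x (r l) * v $ l)"
      by (simp add: c_def sum_distrib_left mult.assoc)
    also have "\<dots> = (\<Sum>l<m. (\<Sum>x<n. C (r q) x * B x (r l)) * v $ l)"
      by (subst sum.swap) (simp add: sum_distrib_right)
    also have "\<dots> = (\<Sum>l<m. (if q = l then v $ l else 0))"
      using range inj that rq
      by (intro sum.cong) (auto simp: inv image_subset_iff inj_on_eq_iff)
    also have "\<dots> = v $ q"
      using that by simp
    finally show ?thesis
      by simp
  qed
  with v(1,2) show False
    by auto
qed

text \<open>The three matrices differ only in column \<open>q\<close>, so they share their cofactors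
  there, and Laplace expansion along that column is linear in its entries.\<close>

lemma det_update_column:
  fixes M :: "nat \<Rightarrow> nat \<Rightarrow> real"
  assumes q: "q < m"
  shows "det (mat m m (\<lambda>(k, l). M k l + (if l = q then t * u k else 0))) =
    det (mat m m (\<lambda>(k, l). M k l)) + t * det (mat m m (\<lambda>(k, l). if l = q then u k else M k l))"
    (is "det ?X = det ?Y + t * det ?Z")
proof -
  have "mat_delete ?X k q = mat_delete ?Y k q" "mat_delete ?Z k q = mat_delete ?Y k q" for k
    unfolding mat_delete_def using q by (auto intro!: eq_matI)
  then have "cofactor ?X k q = cofactor ?Y k q" "cofactor ?Z k q = cofactor ?Y k q" for k
    by (simp_all add: cofactor_def)
  then show ?thesis
    using q laplace_expansion_column[of ?X m q] laplace_expansion_column[of ?Y m q]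
      laplace_expansion_column[of ?Z m q]
    by (simp add: sum.distrib sum_distrib_left algebra_simps)
qed

section \<open>Submatrices through increasing enumerations\<close>

text \<open>Exactly \<open>k\<close> elements of \<open>K\<close> lie below \<open>pick K k\<close>,
  which gives injectivity; counting then gives surjectivity.\<close>

lemma bij_betw_pick:
  assumes "finite K"
  shows "bij_betw (pick K) {..<card K} K"
proof -
  have "inj_on (pick K) {..<card K}"
    by (intro inj_onI) (metis card_pick_le lessThan_iff)
  moreover have "pick K ` {..<card K} \<subseteq> K"
    by (auto intro: pick_in_set_le)
  ultimately show ?thesis
    using assms by (metis bij_betw_def card_image card_lessThan card_subset_eq)
qed

lemma submatrix_eq_mat:
  assumes "K \<subseteq> {..<dim_row M}" "L \<subseteq> {..<dim_col M}"
  shows "submatrix M K L = mat (card K) (card L) (\<lambda>(k, l). M $$ (pick K k, pick L l))"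
proof -
  have "{k. k < dim_row M \<and> k \<in> K} = K" "{l. l < dim_col M \<and> l \<in> L} = L"
    using assms by auto
  then show ?thesis
    by (simp add: submatrix_def)
qed

section \<open>Entries of the inverse and of Sigma\<close>

lemma I_minus_weight_mat_index:
  assumes "k < n" "l < n"
  shows "(1\<^sub>m n - weight_mat n a) $$ (k, l) =
    (if k = l then 1 else if k < l then - a (Suc k, Suc l) else 0)"
  using assms by (auto simp: weight_mat_def dag_edges_def)

lemma sum_inv_left:
  assumes "k < n" "l < n"
  shows "(\<Sum>x<n. (1\<^sub>m n - weight_mat n a) $$ (k, x) * inv_I_minus n a $$ (x, l)) =
    (if k = l then 1 else 0)"
proof -
  have "(\<Sum>x<n. (1\<^sub>m n - weight_mat n a) $$ (k, x) * inv_I_minus n a $$ (x, l)) =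
      ((1\<^sub>m n - weight_mat n a) * inv_I_minus n a) $$ (k, l)"
    using assms inv_I_minus_A(1)[of n a]
    by (auto simp: scalar_prod_def atLeast0LessThan weight_mat_def intro!: sum.cong)
  then show ?thesis
    using assms by (simp add: inv_I_minus_A(2))
qed

lemma inv_I_minus_unique:
  assumes "X \<in> carrier_mat n n" "(1\<^sub>m n - weight_mat n a) * X = 1\<^sub>m n"
  shows "inv_I_minus n a = X"
proof -
  have M: "1\<^sub>m n - weight_mat n a \<in> carrier_mat n n"
    by (simp add: weight_mat_def minus_mat_def)
  have "inv_I_minus n a = inv_I_minus n a * ((1\<^sub>m n - weight_mat n a) * X)"
    using assms inv_I_minus_A(1)[of n a] by simp
  also have "\<dots> = X"
    using assms(1) M inv_I_minus_A(1,3)[of n a]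
    by (simp flip: assoc_mult_mat[of _ n n _ n _ n])
  finally show ?thesis .
qed

lemma Sigma_mat_carrier: "Sigma_mat n a \<in> carrier_mat n n"
  using inv_I_minus_A(1)[of n a] by (simp add: Sigma_mat_def)

lemma Sigma_mat_index:
  assumes "k < n" "l < n"
  shows "Sigma_mat n a $$ (k, l) =
    (\<Sum>x<n. inv_I_minus n a $$ (x, k) * inv_I_minus n a $$ (x, l))"
  using assms inv_I_minus_A(1)[of n a]
  by (auto simp: Sigma_mat_def scalar_prod_def atLeast0LessThan intro!: sum.cong)

text \<open>Back substitution from the last row upwards expresses each entry of the inverse by sums
  and products of coordinates; hence the induction on \<open>n - k\<close>.\<close>

lemma chain_rule_at_inv_I_minus:
  assumes "k < n" "l < n"
  shows "chain_rule_at (dag_edges n) a (\<lambda>x. inv_I_minus n x $$ (k, l))"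
  using assms
proof (induction "n - k" arbitrary: k rule: less_induct)
  case less
  have fin: "finite (dag_edges n)"
    by (rule finite_subset[of _ "{1..n} \<times> {1..n}"]) (auto simp: dag_edges_def)
  text \<open>Row \<open>k\<close> of \<open>B = I + A B\<close> only involves the rows of \<open>B\<close> below it.\<close>
  have rec: "inv_I_minus n x $$ (k, l) =
      (if k = l then 1 else 0) + (\<Sum>y\<in>{k<..<n}. x (Suc k, Suc y) * inv_I_minus n x $$ (y, l))" for x
  proof -
    have "(if k = l then 1 else 0) =
        (\<Sum>y<n. (1\<^sub>m n - weight_mat n x) $$ (k, y) * inv_I_minus n x $$ (y, l))"
      using less.prems sum_inv_left by simp
    also have "\<dots> = (\<Sum>y\<in>{k..<n}. (1\<^sub>m n - weight_mat n x) $$ (k, y) * inv_I_minus n x $$ (y, l))"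
      using less.prems by (intro sum.mono_neutral_right)
        (auto simp: I_minus_weight_mat_index simp del: index_minus_mat)
    also have "{k..<n} = insert k {k<..<n}"
      using less.prems by auto
    also have "(\<Sum>y\<in>insert k {k<..<n}. (1\<^sub>m n - weight_mat n x) $$ (k, y) * inv_I_minus n x $$ (y, l)) =
        inv_I_minus n x $$ (k, l) +
        (\<Sum>y\<in>{k<..<n}. - (x (Suc k, Suc y) * inv_I_minus n x $$ (y, l)))"
      using less.prems
      by (simp add: I_minus_weight_mat_index del: index_minus_mat)
    finally show ?thesis
      by (simp add: sum_negf)
  qed
  show ?case
    unfolding rec
    using less by (intro chain_rule_at_add chain_rule_at_const chain_rule_at_sum chain_rule_at_mult
        chain_rule_at_coord fin) (auto simp: dag_edges_def)
qed

section \<open>Shearing along a line in the parameter space\<close>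

text \<open>The direction along which \<open>I - A\<close> becomes \<open>(I - t E\<^sub>i\<^sub>j) (I - A)\<close>.\<close>

definition shear_direction ::
    "nat \<Rightarrow> nat \<Rightarrow> nat \<Rightarrow> (nat \<times> nat \<Rightarrow> real) \<Rightarrow> nat \<times> nat \<Rightarrow> real" where
  "shear_direction n i j a =
     (\<lambda>(k, l). if k = Suc i then (1\<^sub>m n - weight_mat n a) $$ (j, l - 1) else 0)"

text \<open>With \<open>E\<close> the matrix unit at \<open>(i, j)\<close>, the inverse of
  \<open>(I - t E) (I - A)\<close> is \<open>B (I + t E)\<close>, because \<open>E * E = 0\<close>
  for \<open>i \<noteq> j\<close>.\<close>

lemma inv_I_minus_shear:
  assumes ij: "i < j" "j < n"
  shows "inv_I_minus n (\<lambda>e. a e + t * shear_direction n i j a e) =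
    mat n n (\<lambda>(k, l). inv_I_minus n a $$ (k, l) +
      (if l = j then t * inv_I_minus n a $$ (k, i) else 0))" (is "inv_I_minus n ?a = ?X")
proof (rule inv_I_minus_unique)
  show "?X \<in> carrier_mat n n"
    by simp
  define M where "M k l = (1\<^sub>m n - weight_mat n a) $$ (k, l)" for k l
  define B where "B k l = inv_I_minus n a $$ (k, l)" for k l
  \<comment> \<open>Here \<open>i < j\<close> is essential: for \<open>l \<le> i\<close> the entry
    \<open>M j l\<close> lies below the diagonal and is 0, so subtracting \<open>t\<close> times row
    \<open>j\<close> from row \<open>i\<close> keeps the matrix unit upper triangular and changes
    only entries belonging to edges.\<close>
  have row: "(1\<^sub>m n - weight_mat n ?a) $$ (k, l) = M k l - (if k = i then t * M j l else 0)"
    if "k < n" "l < n" for k l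
    using that ij
    by (auto simp: I_minus_weight_mat_index M_def shear_direction_def simp del: index_minus_mat)
  have MB: "(\<Sum>x<n. M k x * B x l) = (if k = l then 1 else 0)" if "k < n" "l < n" for k l
    using sum_inv_left[OF that] by (simp add: M_def B_def)
  show "(1\<^sub>m n - weight_mat n ?a) * ?X = 1\<^sub>m n"
  proof (rule eq_matI)
    fix k l assume "k < dim_row (1\<^sub>m n :: real mat)" "l < dim_col (1\<^sub>m n :: real mat)"
    then have kl: "k < n" "l < n"
      by auto
    have "((1\<^sub>m n - weight_mat n ?a) * ?X) $$ (k, l) =
        (\<Sum>x<n. (1\<^sub>m n - weight_mat n ?a) $$ (k, x) * ?X $$ (x, l))"
      using kl by (auto simp: scalar_prod_def atLeast0LessThan weight_mat_def intro!: sum.cong)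
    also have "\<dots> = (\<Sum>x<n. (M k x - (if k = i then t * M j x else 0)) *
        (B x l + (if l = j then t * B x i else 0)))"
      using kl by (intro sum.cong) (auto simp: row B_def simp del: index_minus_mat)
    also have "\<dots> = (\<Sum>x<n. M k x * B x l) + (if l = j then t * (\<Sum>x<n. M k x * B x i) else 0)
        - (if k = i then t * (\<Sum>x<n. M j x * B x l) else 0)
        - (if k = i \<and> l = j then t * t * (\<Sum>x<n. M j x * B x i) else 0)"
      by (auto simp: algebra_simps sum.distrib sum_subtractf sum_distrib_left)
    \<comment> \<open>At position \<open>(i, j)\<close> the two terms linear in \<open>t\<close>
      cancel, and elsewhere each of them is 0. The quadratic term vanishes because
      \<open>i \<noteq> j\<close>.\<close>
    also have "\<dots> = 1\<^sub>m n $$ (k, l)"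
      using kl ij by (auto simp: MB)
    finally show "((1\<^sub>m n - weight_mat n ?a) * ?X) $$ (k, l) = 1\<^sub>m n $$ (k, l)" .
  qed (auto simp: weight_mat_def)
qed

section \<open>Nonsingularity for increasing index pairs\<close>

text \<open>The shear changes only column \<open>j\<close> of the inverse, and \<open>j\<close>
  labels exactly one column and no row of the minor. The minor is therefore affine in
  \<open>t\<close>, with slope a Gram determinant up to sign.\<close>

lemma minor_nonsingular:
  assumes ij: "i < j" "j < n" and T: "T \<subseteq> {..<n} - {i, j}"
  shows "nonsingular_hypersurface (dag_edges n)
    (\<lambda>a. det (submatrix (Sigma_mat n a) (insert i T) (insert j T)))"
    (is "nonsingular_hypersurface _ ?f")
proof -
  define K where "K = insert i T"
  define L where "L = insert j T"
  define m where "m = card K"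
  have fin: "finite T"
    using T by (rule finite_subset) auto
  have card: "card L = m"
    using fin T by (auto simp: m_def K_def L_def card_insert_if)
  have bij: "bij_betw (pick K) {..<m} K" "bij_betw (pick L) {..<m} L"
    using bij_betw_pick[of K] bij_betw_pick[of L] fin card by (auto simp: K_def L_def m_def)
  have KL: "K \<subseteq> {..<n}" "L \<subseteq> {..<n}"
    using T ij by (auto simp: K_def L_def)
  have pK: "pick K k \<in> K" "pick K k < n" if "k < m" for k
    using bij_betwE[OF bij(1)] that KL(1) by auto
  have pL: "pick L l \<in> L" "pick L l < n" if "l < m" for l
    using bij_betwE[OF bij(2)] that KL(2) by auto
  have f: "?f a = det (mat m m (\<lambda>(k, l). Sigma_mat n a $$ (pick K k, pick L l)))" for a
    using submatrix_eq_mat[of K "Sigma_mat n a" L] KL Sigma_mat_carrier[of n a] card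
    by (simp add: m_def K_def L_def)
  have "chain_rule_at (dag_edges n) a (\<lambda>x. Sigma_mat n x $$ (k, l))" if "k < n" "l < n" for a k l
    using that by (auto simp: Sigma_mat_index intro!: chain_rule_at_sum chain_rule_at_mult
        chain_rule_at_inv_I_minus)
  then have chain: "chain_rule_at (dag_edges n) a ?f" for a
    unfolding f using pK pL by (intro chain_rule_at_det) auto
  obtain q where q: "q < m" "pick L q = j"
    using bij(2) by (metis L_def bij_betw_def imageE insertI1 lessThan_iff)
  have Lj: "pick L l = j \<longleftrightarrow> l = q" if "l < m" for l
    using bij(2) q that by (metis bij_betw_def inj_on_eq_iff lessThan_iff)
  \<comment> \<open>Putting \<open>i\<close> in the place of \<open>j\<close> turns the enumeration
    of \<open>L\<close> into one of \<open>K\<close>. It need not be increasing, which is the source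
    of the sign.\<close>
  define r where "r l = (if l = q then i else pick L l)" for l
  have r_bij: "bij_betw r {..<m} K"
  proof -
    have "bij_betw (pick L) ({..<m} - {q}) (L - {j})"
      using bij(2) q by (auto simp: bij_betw_def inj_on_def)
    moreover have "L - {j} = T"
      using T by (auto simp: L_def)
    ultimately have "bij_betw r ({..<m} - {q}) T"
      using bij_betw_cong[of "{..<m} - {q}" r "pick L"] by (simp add: r_def)
    moreover have "r q = i" "i \<notin> T"
      using T by (auto simp: r_def)
    ultimately have "bij_betw r (insert q ({..<m} - {q})) (insert i T)"
      using notIn_Un_bij_betw[of q "{..<m} - {q}" r T] by simp
    then show ?thesis
      using q by (simp add: insert_absorb K_def)
  qed
  have rn: "r l < n" if "l < m" for l
    using bij_betwE[OF r_bij] that KL(1) by auto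
  have False if crit: "\<forall>e\<in>dag_edges n. ((\<lambda>t. ?f (a(e := t))) has_real_derivative 0) (at (a e))"
    for a
  proof -
    define v where "v = shear_direction n i j a"
    define G where "G k l = (\<Sum>x<n. inv_I_minus n a $$ (x, k) * inv_I_minus n a $$ (x, l))" for k l
    define c where "c = det (mat m m (\<lambda>(k, l). G (pick K k) (r l)))"
    \<comment> \<open>Both \<open>pick K\<close> and \<open>r\<close> enumerate \<open>K\<close>,
      and the left inverse of the matrix of columns is \<open>I - A\<close>.\<close>
    have "c \<noteq> 0"
      unfolding c_def G_def
      using r_bij bij(1) KL(1)
      by (intro det_gram_nonzero[where C = "\<lambda>k l. (1\<^sub>m n - weight_mat n a) $$ (k, l)"] sum_inv_left)
         (auto simp: bij_betw_def)
    have "?f (\<lambda>e. a e + t * v e) = ?f a + t * c" for t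
    proof -
      \<comment> \<open>For \<open>k \<noteq> j\<close> the left factor of the inner product does
        not move, so no term quadratic in \<open>t\<close> arises.\<close>
      have "Sigma_mat n (\<lambda>e. a e + t * v e) $$ (k, l) =
          G k l + (if l = j then t * G k i else 0)" if "k < n" "l < n" "k \<noteq> j" for k l
        using that ij
        by (simp add: Sigma_mat_index v_def inv_I_minus_shear G_def distrib_left sum.distrib
            sum_distrib_left mult_ac)
      moreover have "pick K k \<noteq> j" if "k < m" for k
        using pK(1)[OF that] T ij by (auto simp: K_def)
      ultimately have "?f (\<lambda>e. a e + t * v e) =
          det (mat m m (\<lambda>(k, l). G (pick K k) (pick L l) + (if l = q then t * G (pick K k) i else 0)))"
        unfolding f using pK pL Lj by (intro arg_cong[of _ _ det] eq_matI) auto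
      also have "\<dots> = det (mat m m (\<lambda>(k, l). G (pick K k) (pick L l))) +
          t * det (mat m m (\<lambda>(k, l). if l = q then G (pick K k) i else G (pick K k) (pick L l)))"
        by (rule det_update_column[OF q(1)])
      also have "det (mat m m (\<lambda>(k, l). G (pick K k) (pick L l))) = ?f a"
        unfolding f using pK pL
        by (intro arg_cong[of _ _ det] eq_matI) (auto simp: Sigma_mat_index G_def)
      also have "(mat m m (\<lambda>(k, l). if l = q then G (pick K k) i else G (pick K k) (pick L l))) =
          mat m m (\<lambda>(k, l). G (pick K k) (r l))"
        by (intro eq_matI) (auto simp: r_def)
      finally show ?thesis
        by (simp add: c_def)
    qed
    moreover have "((\<lambda>t. ?f a + t * c) has_real_derivative c) (at 0)"
      by (auto intro!: derivative_eq_intros)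
    ultimately have "((\<lambda>t. ?f (\<lambda>e. a e + t * v e)) has_real_derivative c) (at 0)"
      by simp
    moreover have "((\<lambda>t. ?f (\<lambda>e. a e + t * v e)) has_real_derivative 0) (at 0)"
      using line_derivative_eq_0[OF chain] crit by blast
    ultimately show False
      using \<open>c \<noteq> 0\<close> DERIV_unique by blast
  qed
  then show ?thesis
    unfolding nonsingular_hypersurface_def by blast
qed

section \<open>Symmetry and the passage to vertex labels\<close>

text \<open>By symmetry of Sigma the two submatrices are transposes of each other. This reduces the
  case \<open>j < i\<close> to \<open>i < j\<close>.\<close>

lemma det_submatrix_Sigma_mat_swap:
  assumes "K \<subseteq> {..<n}" "L \<subseteq> {..<n}" "card K = card L"
  shows "det (submatrix (Sigma_mat n a) K L) = det (submatrix (Sigma_mat n a) L K)"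
proof -
  have fin: "finite K" "finite L"
    using assms finite_subset by auto
  have p: "pick K k < n" "pick L k < n" if "k < card L" for k
    using bij_betwE[OF bij_betw_pick] fin assms that by (metis lessThan_iff subsetD)+
  have eq: "submatrix (Sigma_mat n a) K L =
      mat (card L) (card L) (\<lambda>(k, l). Sigma_mat n a $$ (pick K k, pick L l))"
    "submatrix (Sigma_mat n a) L K =
      mat (card L) (card L) (\<lambda>(k, l). Sigma_mat n a $$ (pick L k, pick K l))"
    using assms Sigma_mat_carrier[of n a] by (simp_all add: submatrix_eq_mat)
  have "submatrix (Sigma_mat n a) K L = transpose_mat (submatrix (Sigma_mat n a) L K)"
    unfolding eq by (intro eq_matI) (auto simp: p Sigma_mat_index mult.commute)
  then show ?thesis
    using det_transpose[of "submatrix (Sigma_mat n a) L K" "card L"] by (simp add: eq(2))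
qed

theorem mainTheorem2:
  fixes n i0 j0 :: nat and S :: "nat set"
  assumes "n \<ge> 1"
    and "i0 \<in> {1..n}" and "j0 \<in> {1..n}" and "i0 \<noteq> j0"
    and "S \<subseteq> {1..n} - {i0, j0}"
  shows "nonsingular_hypersurface (dag_edges n)
           (\<lambda>a. det (vertex_submatrix (Sigma_mat n a) (S \<union> {i0}) (S \<union> {j0})))"
proof -
  \<comment> \<open>Vertices are positive, so they have predecessors; these are the matrix indices
    counted from 0, and \<open>T\<close> is \<open>S\<close> shifted accordingly.\<close>
  obtain i j where ij: "i0 = Suc i" "j0 = Suc j"
    using assms(2,3) by (metis atLeastAtMost_iff not0_implies_Suc not_one_le_zero)
  define T where "T = {k. Suc k \<in> S}"
  have T: "T \<subseteq> {..<n} - {i, j}"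
    using assms(5) by (auto simp: T_def ij)
  have fin: "finite T"
    using T by (rule finite_subset) auto
  have lt: "i < n" "j < n"
    using assms(2,3) by (auto simp: ij)
  have f: "vertex_submatrix M (S \<union> {i0}) (S \<union> {j0}) = submatrix M (insert i T) (insert j T)" for M
  proof -
    have "{k. Suc k \<in> S \<union> {i0}} = insert i T" "{k. Suc k \<in> S \<union> {j0}} = insert j T"
      by (auto simp: T_def ij)
    then show ?thesis
      by (simp add: vertex_submatrix_def)
  qed
  consider "i < j" | "j < i"
    using assms(4) ij by fastforce
  then show ?thesis
  proof cases
    case 1
    then show ?thesis
      unfolding f using lt T by (intro minor_nonsingular)
  next
    case 2
    have "card (insert i T) = card (insert j T)"
      using T fin by (auto simp: card_insert_if)
    then have "det (submatrix (Sigma_mat n a) (insert i T) (insert j T)) =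
        det (submatrix (Sigma_mat n a) (insert j T) (insert i T))" for a
      using T lt by (intro det_submatrix_Sigma_mat_swap) auto
    then show ?thesis
      unfolding f using minor_nonsingular[of j i n T] 2 lt T by (simp add: insert_commute)
  qed
qed

end
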